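(* Let $n,k,d,m$ be positive integers. Let $A(n,k,d,m)$ be the set of integer partitions of $n$ in which exactly $k$ parts are divisible by $d$ and all other parts (i.e. the parts not divisible by $d$) are strictly less than $md$. Let $B(n,k,d,m)$ be the set of integer partitions of $n$ such that: (i) if $m<k$: the largest part is $kd$, and all parts greater than $md$ are divisible by $d$; (ii) if $m\ge k$: the part $k$ occurs at least $d$ times, no part exceeds $md$, and every part $i$ with $k<i\le m$ occurs fewer than $d$ times. Then $|A(n,k,d,m)| = |B(n,k,d,m)|$.
   Context: A partition of $n$ is a finite multiset of positive integers (parts) summing to $n$; parts are counted with multiplicity, so "exactly $k$ parts are divisible by $d$" counts repeated parts each time they occur. *)

theory Defs
  imports "HOL-Library.Multiset"
begin

definition partitions :: "nat \<Rightarrow> nat multiset set" where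
  "partitions n = {p. (\<forall>i\<in>#p. 0 < i) \<and> sum_mset p = n}"

text \<open>Finiteness ensures that \<open>card\<close> on subsets of \<open>partitions n\<close> is the true cardinality.\<close>

lemma finite_partitions: "finite (partitions n)"
proof -
  have "partitions n \<subseteq> mset ` {xs. set xs \<subseteq> {..n} \<and> length xs \<le> n}"
  proof
    fix p assume "p \<in> partitions n"
    then have pos: "\<forall>i\<in>#p. 0 < i" and sum: "sum_mset p = n"
      by (auto simp: partitions_def)
    obtain xs where xs: "mset xs = p" using ex_mset by blast
    have "size p \<le> sum_mset p"
      using pos by (induction p) auto
    moreover have "set_mset p \<subseteq> {..n}"
      using sum by (auto dest!: multi_member_split)
    ultimately show "p \<in> mset ` {xs. set xs \<subseteq> {..n} \<and> length xs \<le> n}"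
      using xs sum by (auto intro!: image_eqI[of _ _ xs])
  qed
  then show ?thesis
    by (rule finite_subset) (intro finite_imageI finite_lists_length_le finite_atMost)
qed

definition A_partitions :: "nat \<Rightarrow> nat \<Rightarrow> nat \<Rightarrow> nat \<Rightarrow> nat multiset set" where
  "A_partitions n k d m =
     {p \<in> partitions n.
        size {#i \<in># p. d dvd i#} = k \<and> (\<forall>i\<in>#p. \<not> d dvd i \<longrightarrow> i < m * d)}"

text \<open>The use of \<open>Max\<close> is meaningful for \<open>n > 0\<close>, as a partition of \<open>n\<close> is then nonempty.\<close>

definition B_partitions :: "nat \<Rightarrow> nat \<Rightarrow> nat \<Rightarrow> nat \<Rightarrow> nat multiset set" where
  "B_partitions n k d m =
     {p \<in> partitions n.
        if m < k
        then Max (set_mset p) = k * d \<and> (\<forall>i\<in>#p. m * d < i \<longrightarrow> d dvd i)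
        else d \<le> count p k \<and> (\<forall>i\<in>#p. i \<le> m * d) \<and>
             (\<forall>i. k < i \<and> i \<le> m \<longrightarrow> count p i < d)}"

end

theory Submission
  imports Defs
begin

text \<open>Conjugating the partition formed by the multiples of \<open>d\<close> (divided by \<open>d\<close>) turns the condition
  that there are \<open>k\<close> of them into the condition that the largest one is \<open>k * d\<close>. For \<open>m < k\<close> this
  already is the set \<open>B\<close>. For \<open>m \<ge> k\<close> the new condition says that \<open>k * d\<close> occurs, that no part exceeds
  \<open>m * d\<close> and that the parts \<open>i * d\<close> with \<open>k < i \<le> m\<close> do not occur. Glaisher's map trades the absence
  of \<open>i * d\<close> for the bound \<open>d\<close> on the multiplicity of \<open>i\<close>, and one part \<open>k * d\<close> is exchanged for \<open>d\<close>
  parts \<open>k\<close>.\<close>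

section \<open>Conjugation of partitions, at the level of cardinalities\<close>

definition sized_msets :: "nat \<Rightarrow> nat \<Rightarrow> nat multiset set" where
  "sized_msets s k = {q. size q = k \<and> sum_mset q = s}"

definition bounded_partitions :: "nat \<Rightarrow> nat \<Rightarrow> nat multiset set" where
  "bounded_partitions s k = {q \<in> partitions s. \<forall>i\<in>#q. i \<le> k}"

lemma finite_sized_msets: "finite (sized_msets s k)"
proof -
  have "sized_msets s k \<subseteq> mset ` {xs. set xs \<subseteq> {..s} \<and> length xs = k}"
  proof
    fix q assume q: "q \<in> sized_msets s k"
    obtain xs where xs: "mset xs = q" using ex_mset by blast
    have "set_mset q \<subseteq> {..s}"
      using q by (auto simp: sized_msets_def dest!: multi_member_split)
    then show "q \<in> mset ` {xs. set xs \<subseteq> {..s} \<and> length xs = k}"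
      using q xs by (auto simp: sized_msets_def intro!: image_eqI[of _ _ xs])
  qed
  then show ?thesis
    by (rule finite_subset) (intro finite_imageI finite_lists_length_eq finite_atMost)
qed

lemma finite_bounded_partitions: "finite (bounded_partitions s k)"
  unfolding bounded_partitions_def using finite_partitions by simp

lemma sum_mset_image_Suc: "sum_mset (image_mset Suc q) = sum_mset q + size q"
  by (induction q) auto

lemma image_Suc_pred:
  assumes "0 \<notin># q"
  shows "image_mset Suc (image_mset (\<lambda>i. i - 1) q) = q"
  using assms by (induction q) auto

text \<open>Adds a first column of length \<open>k\<close> to a Young diagram; the inverse deletes
  it and keeps emptied rows as zeros.\<close>

lemma bij_betw_image_Suc:
  "bij_betw (image_mset Suc) (sized_msets s k) {q \<in> sized_msets (s + k) k. 0 \<notin># q}"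
proof (rule bij_betw_byWitness[where f' = "image_mset (\<lambda>i. i - 1)"])
  show "\<forall>q\<in>sized_msets s k. image_mset (\<lambda>i. i - 1) (image_mset Suc q) = q"
    by (simp add: multiset.map_comp comp_def)
  show "\<forall>q\<in>{q \<in> sized_msets (s + k) k. 0 \<notin># q}. image_mset Suc (image_mset (\<lambda>i. i - 1) q) = q"
    using image_Suc_pred by blast
  show "image_mset Suc ` sized_msets s k \<subseteq> {q \<in> sized_msets (s + k) k. 0 \<notin># q}"
    by (auto simp: sized_msets_def sum_mset_image_Suc)
  show "image_mset (\<lambda>i. i - 1) ` {q \<in> sized_msets (s + k) k. 0 \<notin># q} \<subseteq> sized_msets s k"
  proof clarify
    fix q assume q: "q \<in> sized_msets (s + k) k" "0 \<notin># q"
    show "image_mset (\<lambda>i. i - 1) q \<in> sized_msets s k"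
      using q image_Suc_pred[OF q(2)] sum_mset_image_Suc[of "image_mset (\<lambda>i. i - 1) q"]
      by (simp add: sized_msets_def)
  qed
qed

lemma bij_betw_add_mset_0:
  "bij_betw (add_mset 0) (sized_msets s k) {q \<in> sized_msets s (Suc k). 0 \<in># q}"
  by (rule bij_betw_byWitness[where f' = "\<lambda>q. q - {#0#}"])
     (auto simp: sized_msets_def dest!: multi_member_split)

text \<open>The conjugate of adding a column of length \<open>k\<close>: a row of length
  \<open>k\<close> is added, and it stays the longest.\<close>

lemma bij_betw_add_mset_largest:
  assumes "0 < k"
  shows "bij_betw (add_mset k) (bounded_partitions s k) {q \<in> bounded_partitions (s + k) k. k \<in># q}"
  by (rule bij_betw_byWitness[where f' = "\<lambda>q. q - {#k#}"])
     (use assms in \<open>auto simp: bounded_partitions_def partitions_def dest: in_diffD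
         dest!: multi_member_split[of k]\<close>)

text \<open>Covers, together with the next lemma, the case in which no row or column of length
  \<open>k\<close> can be split off; both sides are then empty.\<close>

lemma no_member_if_sum_less:
  assumes "s < k" shows "{q \<in> bounded_partitions s k. k \<in># q} = {}"
  using assms by (auto simp: bounded_partitions_def partitions_def dest!: multi_member_split)

lemma no_positive_if_sum_less:
  assumes "s < k" shows "{q \<in> sized_msets s k. 0 \<notin># q} = {}"
proof -
  have "size q \<le> sum_mset q" if "0 \<notin># q" for q :: "nat multiset"
    using that by (induction q) auto
  then show ?thesis using assms by (force simp: sized_msets_def)
qed

text \<open>Conjugation of Young diagrams at the level of cardinalities; zero parts are allowed on the
  left, so \<open>size q = k\<close> there encodes at most \<open>k\<close> positive parts.\<close>

lemma card_sized_msets: "card (sized_msets s k) = card (bounded_partitions s k)"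
proof (induction "s + k" arbitrary: s k rule: less_induct)
  case less
  show ?case
  proof (cases k)
    case 0
    \<comment> \<open>Both sets contain at most the empty multiset, and they contain it exactly for
      \<open>s = 0\<close>.\<close>
    have "sized_msets s 0 = bounded_partitions s 0"
      by (auto simp: sized_msets_def bounded_partitions_def partitions_def)
         (metis ex_mset list.set_intros(1) multiset_nonemptyE neq0_conv not_gr_zero set_mset_empty)+
    then show ?thesis using 0 by simp
  next
    case (Suc j)
    \<comment> \<open>Both sides satisfy c(s, k) = c(s, k - 1) + c(s - k, k), with the last term
      absent for \<open>s < k\<close>. Here the last terms are compared; containing \<open>0\<close>
      on the left will match lacking \<open>k\<close> on the right.\<close>
    have pos: "card {q \<in> sized_msets s k. 0 \<notin># q} = card {q \<in> bounded_partitions s k. k \<in># q}"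
    proof (cases "s < k")
      case True
      then show ?thesis by (simp only: no_member_if_sum_less no_positive_if_sum_less)
    next
      case False
      then obtain r where r: "s = r + k" by (metis add.commute le_Suc_ex not_less)
      have "card (sized_msets r k) = card (bounded_partitions r k)"
        using less r Suc by simp
      then show ?thesis
        using bij_betw_same_card[OF bij_betw_image_Suc[of r k]]
          bij_betw_same_card[OF bij_betw_add_mset_largest[of k r]] r Suc by simp
    qed
    have "card (sized_msets s k) =
        card {q \<in> sized_msets s k. 0 \<in># q} + card {q \<in> sized_msets s k. 0 \<notin># q}"
      by (subst card_Un_disjoint[symmetric]) (auto simp: finite_sized_msets intro!: arg_cong[of _ _ card])
    also have "card {q \<in> sized_msets s k. 0 \<in># q} = card (bounded_partitions s j)"
      using bij_betw_same_card[OF bij_betw_add_mset_0[of s j]] less[of s j] Suc by simp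
    also have "bounded_partitions s j = {q \<in> bounded_partitions s k. k \<notin># q}"
      using Suc by (auto simp: bounded_partitions_def le_Suc_eq)
    also have "card {q \<in> bounded_partitions s k. k \<notin># q} + card {q \<in> sized_msets s k. 0 \<notin># q} =
        card (bounded_partitions s k)"
      unfolding pos
      by (subst card_Un_disjoint[symmetric])
         (auto simp: finite_bounded_partitions intro!: arg_cong[of _ _ card])
    finally show ?thesis .
  qed
qed

text \<open>Deleting the first column on the left and one part \<open>k\<close> on the right reduces
  this to the previous lemma for total \<open>s - k\<close>.\<close>

lemma card_size_eq_card_largest:
  assumes "0 < k"
  shows "card {q \<in> partitions s. size q = k} = card {q \<in> partitions s. k \<in># q \<and> (\<forall>i\<in>#q. i \<le> k)}"
proof -
  have A: "{q \<in> partitions s. size q = k} = {q \<in> sized_msets s k. 0 \<notin># q}"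
    by (auto simp: partitions_def sized_msets_def intro: gr0I)
  have B: "{q \<in> partitions s. k \<in># q \<and> (\<forall>i\<in>#q. i \<le> k)} = {q \<in> bounded_partitions s k. k \<in># q}"
    by (auto simp: bounded_partitions_def)
  show ?thesis
  proof (cases "s < k")
    case True
    then show ?thesis unfolding A B by (simp only: no_member_if_sum_less no_positive_if_sum_less)
  next
    case False
    then obtain r where r: "s = r + k" by (metis add.commute le_Suc_ex not_less)
    show ?thesis unfolding A B unfolding r
      using bij_betw_same_card[OF bij_betw_image_Suc[of r k]] card_sized_msets[of r k]
        bij_betw_same_card[OF bij_betw_add_mset_largest[of k r]] assms by simp
  qed
qed

section \<open>Splitting a partition into multiples and nonmultiples of \<open>d\<close>\<close>

definition nonmultiples :: "nat \<Rightarrow> nat multiset \<Rightarrow> nat multiset" where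
  "nonmultiples d p = {#i \<in># p. \<not> d dvd i#}"

definition quotients :: "nat \<Rightarrow> nat multiset \<Rightarrow> nat multiset" where
  "quotients d p = {#i div d. i \<in># {#i \<in># p. d dvd i#}#}"

text \<open>With the next two lemmas, a partition is encoded without loss by its nonmultiples and
  its quotients, and the quotients can be replaced freely.\<close>

lemma nonmultiples_quotients: "nonmultiples d p + image_mset ((*) d) (quotients d p) = p"
  by (induction p) (auto simp: nonmultiples_def quotients_def)

lemma nonmultiples_add: "nonmultiples d (nonmultiples d p + image_mset ((*) d) q) = nonmultiples d p"
  by (induction p) (auto simp: nonmultiples_def filter_mset_image_mset)

lemma quotients_add:
  assumes "0 < d"
  shows "quotients d (nonmultiples d p + image_mset ((*) d) q) = q"
  using assms
  by (auto simp: nonmultiples_def quotients_def filter_mset_image_mset multiset.map_comp comp_def)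

lemma sum_mset_image_times: "sum_mset (image_mset ((*) d) q) = d * sum_mset (q :: nat multiset)"
  by (induction q) (auto simp: algebra_simps)

text \<open>A weight-preserving correspondence between two properties of the multiples of \<open>d\<close> extends
  to whole partitions by leaving the other parts alone.\<close>

lemma card_replace_multiples:
  assumes d: "0 < d"
    and card: "\<And>s. card {q \<in> partitions s. X q} = card {q \<in> partitions s. Y q}"
  shows "card {p \<in> partitions n. R (nonmultiples d p) \<and> X (quotients d p)} =
         card {p \<in> partitions n. R (nonmultiples d p) \<and> Y (quotients d p)}"
proof -
  \<comment> \<open>Equal cardinalities of finite sets provide some bijection for each weight
    \<open>s\<close>; no explicit conjugation map is needed.\<close>
  have "\<exists>f. bij_betw f {q \<in> partitions s. X q} {q \<in> partitions s. Y q}" for s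
    by (rule finite_same_card_bij) (auto simp: finite_partitions card)
  then obtain f where f: "\<And>s. bij_betw (f s) {q \<in> partitions s. X q} {q \<in> partitions s. Y q}"
    by metis
  define g where "g s = inv_into {q \<in> partitions s. X q} (f s)" for s
  have g: "bij_betw (g s) {q \<in> partitions s. Y q} {q \<in> partitions s. X q}" for s
    unfolding g_def by (rule bij_betw_inv_into[OF f])
  have gf: "g s (f s q) = q" if "q \<in> partitions s" "X q" for s q
    unfolding g_def using that by (intro bij_betw_inv_into_left[OF f]) auto
  have fg: "f s (g s q) = q" if "q \<in> partitions s" "Y q" for s q
    unfolding g_def using that by (intro bij_betw_inv_into_right[OF f]) auto
  \<comment> \<open>The bijection applied is the one for the weight of the quotients, so the sum of
    the whole partition is preserved.\<close>
  define lift where "lift h p = nonmultiples d p +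
      image_mset ((*) d) (h (sum_mset (quotients d p)) (quotients d p))"
    for h :: "nat \<Rightarrow> nat multiset \<Rightarrow> nat multiset" and p
  have nm: "nonmultiples d (lift h p) = nonmultiples d p" for h p
    by (simp add: lift_def nonmultiples_add)
  have qu: "quotients d (lift h p) = h (sum_mset (quotients d p)) (quotients d p)" for h p
    by (simp add: lift_def quotients_add d)
  have quot_part: "quotients d p \<in> partitions (sum_mset (quotients d p))"
    if "p \<in> partitions n" for p
    using that d by (auto simp: partitions_def quotients_def elim!: dvdE)
  have lift_part: "lift h p \<in> partitions n"
    if p: "p \<in> partitions n"
      and h: "h (sum_mset (quotients d p)) (quotients d p) \<in> partitions (sum_mset (quotients d p))"
    for h p
  proof -
    have "sum_mset (lift h p) = sum_mset (nonmultiples d p + image_mset ((*) d) (quotients d p))"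
      using h by (simp add: lift_def partitions_def sum_mset_image_times)
    then have "sum_mset (lift h p) = n"
      using p by (simp add: nonmultiples_quotients partitions_def)
    moreover have "\<forall>i\<in>#lift h p. 0 < i"
      using p h d by (auto simp: lift_def partitions_def nonmultiples_def)
    ultimately show ?thesis by (simp add: partitions_def)
  qed
  have fX: "f s q \<in> partitions s \<and> Y (f s q)" if "q \<in> partitions s" "X q" for s q
    using bij_betwE[OF f] that by auto
  have gY: "g s q \<in> partitions s \<and> X (g s q)" if "q \<in> partitions s" "Y q" for s q
    using bij_betwE[OF g] that by auto
  have sum: "sum_mset q = s" if "q \<in> partitions s" for q s
    using that by (simp add: partitions_def)
  have eqI: "p = p'" if "nonmultiples d p = nonmultiples d p'" "quotients d p = quotients d p'" for p p'
    using that nonmultiples_quotients by metis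
  have "bij_betw (lift f)
      {p \<in> partitions n. R (nonmultiples d p) \<and> X (quotients d p)}
      {p \<in> partitions n. R (nonmultiples d p) \<and> Y (quotients d p)}"
  proof (rule bij_betw_byWitness[where f' = "lift g"])
    have "lift g (lift f p) = p" if "p \<in> partitions n" "X (quotients d p)" for p
    proof (rule eqI)
      have "sum_mset (f (sum_mset (quotients d p)) (quotients d p)) = sum_mset (quotients d p)"
        using fX[OF quot_part[OF that(1)] that(2)] sum by blast
      then show "quotients d (lift g (lift f p)) = quotients d p"
        by (simp only: qu gf[OF quot_part[OF that(1)] that(2)])
    qed (simp only: nm)
    then show "\<forall>p\<in>{p \<in> partitions n. R (nonmultiples d p) \<and> X (quotients d p)}. lift g (lift f p) = p"
      by blast
    have "lift f (lift g p) = p" if "p \<in> partitions n" "Y (quotients d p)" for p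
    proof (rule eqI)
      have "sum_mset (g (sum_mset (quotients d p)) (quotients d p)) = sum_mset (quotients d p)"
        using gY[OF quot_part[OF that(1)] that(2)] sum by blast
      then show "quotients d (lift f (lift g p)) = quotients d p"
        by (simp only: qu fg[OF quot_part[OF that(1)] that(2)])
    qed (simp only: nm)
    then show "\<forall>p\<in>{p \<in> partitions n. R (nonmultiples d p) \<and> Y (quotients d p)}. lift f (lift g p) = p"
      by blast
  qed (use fX gY quot_part lift_part in \<open>auto simp: nm qu\<close>)
  then show ?thesis by (rule bij_betw_same_card)
qed

section \<open>A common normal form for both sets, and the case \<open>m < k\<close>\<close>

text \<open>Conjugates the quotients: having \<open>k\<close> of them becomes having largest
  quotient \<open>k\<close>, that is, largest multiple \<open>k * d\<close>.\<close>

lemma card_A_partitions: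
  assumes "0 < d" "0 < k"
  shows "card (A_partitions n k d m) =
    card {p \<in> partitions n. (\<forall>i\<in>#p. \<not> d dvd i \<longrightarrow> i < m * d) \<and>
            k * d \<in># p \<and> (\<forall>i\<in>#p. d dvd i \<longrightarrow> i \<le> k * d)}"
proof -
  have "A_partitions n k d m =
    {p \<in> partitions n. (\<forall>i\<in>#nonmultiples d p. i < m * d) \<and> size (quotients d p) = k}"
    by (auto simp: A_partitions_def nonmultiples_def quotients_def)
  moreover have "k \<in># quotients d p \<longleftrightarrow> k * d \<in># p" for p
    using assms by (auto simp: quotients_def image_iff)
  then have "{p \<in> partitions n. (\<forall>i\<in>#p. \<not> d dvd i \<longrightarrow> i < m * d) \<and>
            k * d \<in># p \<and> (\<forall>i\<in>#p. d dvd i \<longrightarrow> i \<le> k * d)} =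
    {p \<in> partitions n. (\<forall>i\<in>#nonmultiples d p. i < m * d) \<and>
        (k \<in># quotients d p \<and> (\<forall>i\<in>#quotients d p. i \<le> k))}"
    using assms by (auto simp: nonmultiples_def quotients_def elim!: dvdE simp: mult.commute)
  ultimately show ?thesis
    using card_replace_multiples[OF assms(1) card_size_eq_card_largest[OF assms(2)],
        of n "\<lambda>u. \<forall>i\<in>#u. i < m * d"]
    by simp
qed

text \<open>A nonmultiple of \<open>d\<close> differs from \<open>m * d\<close>, so it lies strictly
  below or above; as \<open>m * d < k * d\<close>, the largest part overall is then the largest
  multiple.\<close>

lemma B_partitions_less:
  assumes "0 < n" "0 < d" "m < k"
  shows "B_partitions n k d m = {p \<in> partitions n. (\<forall>i\<in>#p. \<not> d dvd i \<longrightarrow> i < m * d) \<and>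
            k * d \<in># p \<and> (\<forall>i\<in>#p. d dvd i \<longrightarrow> i \<le> k * d)}"
proof -
  have md: "m * d < k * d" using assms by simp
  have "Max (set_mset p) = k * d \<and> (\<forall>i\<in>#p. m * d < i \<longrightarrow> d dvd i) \<longleftrightarrow>
      (\<forall>i\<in>#p. \<not> d dvd i \<longrightarrow> i < m * d) \<and> k * d \<in># p \<and> (\<forall>i\<in>#p. d dvd i \<longrightarrow> i \<le> k * d)"
    if "p \<in> partitions n" for p
  proof -
    have "p \<noteq> {#}" using that assms by (auto simp: partitions_def)
    then have "Max (set_mset p) = k * d \<longleftrightarrow> k * d \<in># p \<and> (\<forall>i\<in>#p. i \<le> k * d)"
      by (subst Max_eq_iff) auto
    moreover have "i < m * d \<or> m * d < i" if "\<not> d dvd i" for i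
      using that by (metis dvd_triv_right linorder_neqE_nat)
    ultimately show ?thesis using md by (meson less_le_trans less_imp_le not_le)
  qed
  then show ?thesis using assms by (auto simp: B_partitions_def)
qed

section \<open>Glaisher's map\<close>

text \<open>Glaisher's map one part at a time: the multiplicity \<open>a\<close> of \<open>t\<close> is split into \<open>a mod d\<close>
  copies of \<open>t\<close> and \<open>a div d\<close> copies of \<open>d * t\<close>.\<close>

lemma card_Glaisher_step:
  assumes d: "1 < d" and t: "0 < t"
    and P: "\<And>p p'. (\<And>i. i \<noteq> t \<Longrightarrow> i \<noteq> t * d \<Longrightarrow> count p i = count p' i) \<Longrightarrow> P p = P p'"
  shows "card {p \<in> partitions n. P p \<and> t * d \<notin># p} = card {p \<in> partitions n. P p \<and> count p t < d}"
proof -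
  have ne: "t * d \<noteq> t" "0 < t * d" using d t by auto
  define f where "f p = (p - replicate_mset (d * (count p t div d)) t) + replicate_mset (count p t div d) (t * d)"
    for p
  define g where "g p = (p - replicate_mset (count p (t * d)) (t * d)) + replicate_mset (d * count p (t * d)) t"
    for p
  have countf: "count (f p) i = (if i = t then count p t mod d else if i = t * d then
      count p (t * d) + count p t div d else count p i)" for p i
    using ne by (auto simp: f_def minus_mult_div_eq_mod)
  have countg: "count (g p) i = (if i = t then count p t + d * count p (t * d) else if i = t * d then
      0 else count p i)" for p i
    using ne by (auto simp: g_def)
  have sumf: "sum_mset (f p) = sum_mset p" for p
  proof -
    have "replicate_mset (d * (count p t div d)) t \<subseteq># p"
      by (simp add: count_le_replicate_mset_subset_eq[symmetric])
    then obtain r where "p = replicate_mset (d * (count p t div d)) t + r"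
      by (metis subset_mset.add_diff_inverse)
    then have "sum_mset p = sum_mset (replicate_mset (d * (count p t div d)) t) + sum_mset r"
      "f p = r + replicate_mset (count p t div d) (t * d)"
      unfolding f_def by (metis sum_mset.union, metis add_diff_cancel_left')
    then show ?thesis by (simp add: algebra_simps)
  qed
  have sumg: "sum_mset (g p) = sum_mset p" for p
  proof -
    have "replicate_mset (count p (t * d)) (t * d) \<subseteq># p"
      by (simp add: count_le_replicate_mset_subset_eq[symmetric])
    then obtain r where "p = replicate_mset (count p (t * d)) (t * d) + r"
      by (metis subset_mset.add_diff_inverse)
    then have "sum_mset p = sum_mset (replicate_mset (count p (t * d)) (t * d)) + sum_mset r"
      "g p = r + replicate_mset (d * count p (t * d)) t"
      unfolding g_def by (metis sum_mset.union, metis add_diff_cancel_left')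
    then show ?thesis by (simp add: algebra_simps)
  qed
  have partf: "f p \<in> partitions n" and partg: "g p \<in> partitions n" if "p \<in> partitions n" for p
    using that t ne sumf sumg
    by (auto simp: partitions_def f_def g_def dest: in_diffD)
  \<comment> \<open>Both maps change only the multiplicities of \<open>t\<close> and
    \<open>t * d\<close>, which \<open>P\<close> ignores.\<close>
  have Pf: "P (f p) = P p" and Pg: "P (g p) = P p" for p
    by (rule P; simp add: countf countg)+
  have "bij_betw f {p \<in> partitions n. P p \<and> t * d \<notin># p} {p \<in> partitions n. P p \<and> count p t < d}"
  proof (rule bij_betw_byWitness[where f' = g])
    show "\<forall>p\<in>{p \<in> partitions n. P p \<and> t * d \<notin># p}. g (f p) = p"
      using ne by (auto intro!: multiset_eqI simp: countf countg not_in_iff)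
    show "\<forall>p\<in>{p \<in> partitions n. P p \<and> count p t < d}. f (g p) = p"
      using ne by (auto intro!: multiset_eqI simp: countf countg)
  qed (use d ne in \<open>auto simp: Pf Pg partf partg countf countg not_in_iff\<close>)
  then show ?thesis by (rule bij_betw_same_card)
qed

text \<open>Descending induction on \<open>t\<close>: when \<open>t\<close> is treated, the bound on the
  multiplicity of \<open>d * t > t\<close> has already been traded away.\<close>

lemma card_Glaisher_chain:
  assumes d: "0 < d" and k: "k \<le> t" "t \<le> m"
  shows "card {p \<in> partitions n. d \<le> count p k \<and> (\<forall>i\<in>#p. i \<le> m * d) \<and>
            (\<forall>i. k < i \<and> i \<le> t \<longrightarrow> count p i < d) \<and> (\<forall>i. t < i \<and> i \<le> m \<longrightarrow> i * d \<notin># p)} =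
         card {p \<in> partitions n. d \<le> count p k \<and> (\<forall>i\<in>#p. i \<le> m * d) \<and>
            (\<forall>i. k < i \<and> i \<le> m \<longrightarrow> count p i < d)}"
  using k(2,1)
proof (induction t rule: inc_induct)
  case base
  have "(\<forall>i. m < i \<and> i \<le> m \<longrightarrow> i * d \<notin># p) \<longleftrightarrow> True" for p
    by auto
  then show ?case by simp
next
  case (step t)
  show ?case
  proof (cases "d = 1")
    \<comment> \<open>Here \<open>t * d = t\<close>, so no Glaisher step exists; but multiplicity
      below \<open>1\<close> already means absence.\<close>
    case True
    have "(\<forall>i. k < i \<and> i \<le> t \<longrightarrow> count p i < d) \<and> (\<forall>i. t < i \<and> i \<le> m \<longrightarrow> i * d \<notin># p) \<longleftrightarrow>
        (\<forall>i. k < i \<and> i \<le> m \<longrightarrow> count p i < d)" for p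
      using True step by (simp add: not_in_iff) (meson le_less_trans less_imp_le less_le_trans not_le)
    then show ?thesis by simp
  next
    case False
    then have d1: "1 < d" using d by simp
    \<comment> \<open>The size bound exempts \<open>Suc t\<close> and \<open>Suc t * d\<close> to
      make \<open>P\<close> independent of their multiplicities. Nothing is lost, since both are at
      most \<open>m * d\<close>.\<close>
    define P where "P p \<longleftrightarrow> d \<le> count p k \<and> (\<forall>i. i \<noteq> Suc t \<and> i \<noteq> Suc t * d \<and> i \<in># p \<longrightarrow> i \<le> m * d) \<and>
       (\<forall>i. k < i \<and> i \<le> t \<longrightarrow> count p i < d) \<and> (\<forall>i. Suc t < i \<and> i \<le> m \<longrightarrow> i * d \<notin># p)" for p
    have tm: "Suc t * d \<le> m * d" using step by (intro mult_le_mono1) simp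
    have "Suc t \<le> Suc t * d" using d by (simp del: mult_Suc)
    then have tm': "Suc t \<le> m * d" using tm by (rule le_trans)
    have bound: "(\<forall>i\<in>#p. i \<le> m * d) \<longleftrightarrow> (\<forall>i. i \<noteq> Suc t \<and> i \<noteq> Suc t * d \<and> i \<in># p \<longrightarrow> i \<le> m * d)" for p
      using tm tm' by metis
    have less: "i < Suc t * d" if "i \<le> Suc t" for i
    proof -
      have "Suc t < Suc t * d" using d1 by (simp del: mult_Suc)
      with that show ?thesis by (rule le_less_trans)
    qed
    have "P p = P p'" if eq: "\<And>i. i \<noteq> Suc t \<Longrightarrow> i \<noteq> Suc t * d \<Longrightarrow> count p i = count p' i" for p p'
    proof -
      have 1: "count p i = count p' i" if "i \<le> t" for i
        using that less[of i] by (intro eq) auto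
      \<comment> \<open>The parts still forbidden exceed \<open>Suc t * d\<close>, hence also
        \<open>Suc t\<close>.\<close>
      have 2: "i * d \<in># p \<longleftrightarrow> i * d \<in># p'" if "Suc t < i" for i
      proof -
        have "i * d \<noteq> Suc t * d" "i * d \<noteq> Suc t"
          using that d less[of "Suc t"] mult_less_mono1[OF that d] by linarith+
        then show ?thesis using eq[of "i * d"] by (metis count_eq_zero_iff)
      qed
      have 3: "i \<in># p \<longleftrightarrow> i \<in># p'" if "i \<noteq> Suc t \<and> i \<noteq> Suc t * d" for i
        using eq[of i] that by (metis count_eq_zero_iff)
      show ?thesis unfolding P_def using 1 2 3 step.prems by (smt (verit, best))
    qed
    then have "card {p \<in> partitions n. P p \<and> Suc t * d \<notin># p} =
        card {p \<in> partitions n. P p \<and> count p (Suc t) < d}"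
      by (rule card_Glaisher_step[OF d1 zero_less_Suc])
    moreover have "{p \<in> partitions n. P p \<and> Suc t * d \<notin># p} =
      {p \<in> partitions n. d \<le> count p k \<and> (\<forall>i\<in>#p. i \<le> m * d) \<and>
         (\<forall>i. k < i \<and> i \<le> t \<longrightarrow> count p i < d) \<and> (\<forall>i. t < i \<and> i \<le> m \<longrightarrow> i * d \<notin># p)}"
      unfolding P_def bound using step.hyps by (auto simp del: mult_Suc) (metis Suc_lessI)
    moreover have "{p \<in> partitions n. P p \<and> count p (Suc t) < d} =
      {p \<in> partitions n. d \<le> count p k \<and> (\<forall>i\<in>#p. i \<le> m * d) \<and>
         (\<forall>i. k < i \<and> i \<le> Suc t \<longrightarrow> count p i < d) \<and> (\<forall>i. Suc t < i \<and> i \<le> m \<longrightarrow> i * d \<notin># p)}"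
      unfolding P_def bound using step.prems by (auto simp del: mult_Suc simp: le_Suc_eq)
    ultimately show ?thesis using step by simp
  qed
qed

section \<open>The case \<open>k \<le> m\<close>\<close>

text \<open>The chain from \<open>t = k\<close> removes all multiplicity bounds; then
  \<open>d\<close> parts \<open>k\<close> are merged into one part \<open>k * d\<close>. This
  respects \<open>P\<close>, because \<open>k\<close> and \<open>k * d\<close> are at most
  \<open>m * d\<close> and neither is a forbidden \<open>i * d\<close> with
  \<open>k < i\<close>.\<close>

lemma card_B_partitions_ge:
  assumes "0 < d" "0 < k" "k \<le> m"
  shows "card (B_partitions n k d m) = card {p \<in> partitions n. (\<forall>i\<in>#p. \<not> d dvd i \<longrightarrow> i < m * d) \<and>
            k * d \<in># p \<and> (\<forall>i\<in>#p. d dvd i \<longrightarrow> i \<le> k * d)}"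
proof -
  define P where "P p \<longleftrightarrow> (\<forall>i\<in>#p. i \<le> m * d) \<and> (\<forall>i. k < i \<and> i \<le> m \<longrightarrow> i * d \<notin># p)" for p
  have kd: "k * d \<le> m * d" using assms by simp
  have "k \<le> k * d" using assms by simp
  then have k_le: "k \<le> m * d" using kd by (rule le_trans)
  have ne: "i * d \<noteq> k" "i * d \<noteq> k * d" if "k < i" for i
    using that assms mult_le_mono2[of 1 d i] by auto
  have "card (B_partitions n k d m) = card {p \<in> partitions n. d \<le> count p k \<and> P p}"
    using card_Glaisher_chain[OF assms(1) order.refl assms(3), of n] assms
    by (simp add: B_partitions_def P_def conj_ac)
  also have "bij_betw (\<lambda>p. add_mset (k * d) (p - replicate_mset d k))
      {p \<in> partitions n. d \<le> count p k \<and> P p} {p \<in> partitions n. k * d \<in># p \<and> P p}"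
  proof (rule bij_betw_byWitness[where f' = "\<lambda>p. (p - {#k * d#}) + replicate_mset d k"])
    show "\<forall>p\<in>{p \<in> partitions n. d \<le> count p k \<and> P p}.
        add_mset (k * d) (p - replicate_mset d k) - {#k * d#} + replicate_mset d k = p"
      by (auto simp: count_le_replicate_mset_subset_eq)
    show "\<forall>p\<in>{p \<in> partitions n. k * d \<in># p \<and> P p}.
        add_mset (k * d) (p - {#k * d#} + replicate_mset d k - replicate_mset d k) = p"
      by auto
    show "(\<lambda>p. add_mset (k * d) (p - replicate_mset d k)) ` {p \<in> partitions n. d \<le> count p k \<and> P p}
        \<subseteq> {p \<in> partitions n. k * d \<in># p \<and> P p}"
    proof clarify
      fix p assume p: "p \<in> partitions n" "d \<le> count p k" "P p"
      then obtain r where r: "p = replicate_mset d k + r"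
        by (metis count_le_replicate_mset_subset_eq subset_mset.add_diff_inverse)
      show "add_mset (k * d) (p - replicate_mset d k) \<in> partitions n \<and>
          k * d \<in># add_mset (k * d) (p - replicate_mset d k) \<and> P (add_mset (k * d) (p - replicate_mset d k))"
        using p assms kd ne unfolding r by (auto simp: partitions_def P_def)
    qed
    show "(\<lambda>p. p - {#k * d#} + replicate_mset d k) ` {p \<in> partitions n. k * d \<in># p \<and> P p}
        \<subseteq> {p \<in> partitions n. d \<le> count p k \<and> P p}"
    proof clarify
      fix p assume p: "p \<in> partitions n" "k * d \<in># p" "P p"
      then obtain r where r: "p = add_mset (k * d) r"
        by (metis multi_member_split)
      show "p - {#k * d#} + replicate_mset d k \<in> partitions n \<and>
          d \<le> count (p - {#k * d#} + replicate_mset d k) k \<and> P (p - {#k * d#} + replicate_mset d k)"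
        using p assms k_le ne unfolding r by (auto simp: partitions_def P_def)
    qed
  qed
  then have "card {p \<in> partitions n. d \<le> count p k \<and> P p} = card {p \<in> partitions n. k * d \<in># p \<and> P p}"
    by (rule bij_betw_same_card)
  also have "P p \<longleftrightarrow> (\<forall>i\<in>#p. \<not> d dvd i \<longrightarrow> i < m * d) \<and> (\<forall>i\<in>#p. d dvd i \<longrightarrow> i \<le> k * d)" for p
  proof
    assume P: "P p"
    have "i < m * d" if "i \<in># p" "\<not> d dvd i" for i
      using P that by (metis P_def dvd_triv_right le_neq_implies_less)
    moreover have "i \<le> k * d" if i: "i \<in># p" "d dvd i" for i
    proof -
      obtain j where j: "i = j * d" using i(2) by (metis dvdE mult.commute)
      \<comment> \<open>The size bound brings \<open>j\<close> into the range up to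
        \<open>m\<close>, where every index above \<open>k\<close> is forbidden.\<close>
      have "j \<le> m" using P i(1) assms unfolding j P_def by force
      then have "j \<le> k" using P i(1) unfolding j P_def by (meson not_le)
      then show ?thesis unfolding j by simp
    qed
    ultimately show "(\<forall>i\<in>#p. \<not> d dvd i \<longrightarrow> i < m * d) \<and> (\<forall>i\<in>#p. d dvd i \<longrightarrow> i \<le> k * d)"
      by blast
  next
    assume R: "(\<forall>i\<in>#p. \<not> d dvd i \<longrightarrow> i < m * d) \<and> (\<forall>i\<in>#p. d dvd i \<longrightarrow> i \<le> k * d)"
    have "i * d \<notin># p" if "k < i" for i
      using R mult_less_mono1[OF that assms(1)] by (metis dvd_triv_right not_le)
    then show "P p"
      using R kd unfolding P_def by (meson le_trans less_imp_le)
  qed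
  then have "{p \<in> partitions n. k * d \<in># p \<and> P p} =
      {p \<in> partitions n. (\<forall>i\<in>#p. \<not> d dvd i \<longrightarrow> i < m * d) \<and>
            k * d \<in># p \<and> (\<forall>i\<in>#p. d dvd i \<longrightarrow> i \<le> k * d)}"
    by blast
  finally show ?thesis .
qed

theorem theorem2p3:
  fixes n k d m :: nat
  assumes "0 < n" and "0 < k" and "0 < d" and "0 < m"
  shows "card (A_partitions n k d m) = card (B_partitions n k d m)"
  using assms card_A_partitions B_partitions_less card_B_partitions_ge
  by (cases "m < k") simp_all

end
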